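(* Let $K \ge 1$, let $(\mathcal{X}_k, d_k)$, $k = 1, \dots, K$, be non-empty metric spaces, let $\mathcal{X} = \mathcal{X}_1 \times \dots \times \mathcal{X}_K$, let $L_1, \dots, L_K \ge 0$, let $\mathcal{O} \subseteq \mathcal{X}$, and let $G \colon \mathcal{X} \to \mathbb{R}$ be $d_L$-short. Let $$\mathcal{E}(\mathcal{X}, G|_{\mathcal{O}}, d_L) := \{ g \colon \mathcal{X} \to \mathbb{R} \mid g \text{ is } d_L\text{-short and } g = G \text{ on } \mathcal{O} \}.$$ Fix $k \in \{1, \dots, K\}$ and let $\widehat{D}_k$ be the optimal value (supremum) of $|y - y'|$ among all $(x, y), (x', y') \in \mathcal{X} \times \mathbb{R}$ satisfying - $x^i = x'^i$ for all $i \in \{1, \dots, K\} \setminus \{k\}$; - $|y - y'| \le L_k d_k(x^k, x'^k)$; - $|y - G(z)| \le d_L(x, z)$ and $|y' - G(z)| \le d_L(x', z)$ for all $z \in \mathcal{O}$. Then $$\widehat{D}_k = \sup \{ \mathcal{D}_k[g] \mid g \in \mathcal{E}(\mathcal{X}, G|_{\mathcal{O}}, d_L) \}.$$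
   Context: Points of $\mathcal{X}$ are written $x = (x^1, \dots, x^K)$ with $x^k \in \mathcal{X}_k$. Define $d_L(x, x') := \sum_{k=1}^K L_k d_k(x^k, x'^k)$ for $x, x' \in \mathcal{X}$. A real-valued function $f$ on a subset of $\mathcal{X}$ is called $d_L$-short if $|f(x) - f(x')| \le d_L(x, x')$ for all $x, x'$ in its domain. The $k$-th McDiarmid subdiameter of $f \colon \mathcal{X} \to \mathbb{R}$ is $$\mathcal{D}_k[f] := \sup\{ |f(x) - f(x')| \mid x, x' \in \mathcal{X},\ x^j = x'^j \text{ for } j \ne k \}.$$ Suprema are taken in $[0, +\infty]$. *)

theory Defs
  imports "HOL-Analysis.Analysis"
begin

text \<open>
  The spaces are a family of carriers \<open>M k\<close> with metrics \<open>d k\<close>, for \<open>k \<in> {1..K}\<close>, all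
  inside one type \<open>'a\<close>. This is no restriction, since finitely many sets of different types
  embed into their disjoint sum. The product is the extensional one, \<open>PiE {1..K} M\<close>, and only
  the values of \<open>d k\<close> on \<open>M k\<close> matter. \<^locale>\<open>Metric_space\<close> also asks for symmetry and
  nonnegativity off the carrier, which any metric on \<open>M k\<close> satisfies once extended by \<open>0\<close>.
\<close>

definition weighted_dist ::
    "nat \<Rightarrow> (nat \<Rightarrow> real) \<Rightarrow> (nat \<Rightarrow> 'a \<Rightarrow> 'a \<Rightarrow> real) \<Rightarrow> (nat \<Rightarrow> 'a) \<Rightarrow> (nat \<Rightarrow> 'a) \<Rightarrow> real"
  where "weighted_dist K L d x x' = (\<Sum>k=1..K. L k * d k (x k) (x' k))"

definition short_on :: "'b set \<Rightarrow> ('b \<Rightarrow> 'b \<Rightarrow> real) \<Rightarrow> ('b \<Rightarrow> real) \<Rightarrow> bool"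
  where "short_on S \<rho> f \<longleftrightarrow> (\<forall>x\<in>S. \<forall>x'\<in>S. \<bar>f x - f x'\<bar> \<le> \<rho> x x')"

text \<open>
  The functions \<open>g\<close> are extensional on \<open>X\<close>, so that they are exactly the functions from \<open>X\<close>
  to the reals. The argument \<open>h\<close> matters only through its values on \<open>Obs\<close>, which stands
  for the set \<open>\<O>\<close>.
\<close>

definition short_extensions ::
    "'b set \<Rightarrow> 'b set \<Rightarrow> ('b \<Rightarrow> real) \<Rightarrow> ('b \<Rightarrow> 'b \<Rightarrow> real) \<Rightarrow> ('b \<Rightarrow> real) set"
  where "short_extensions X Obs h \<rho> =
    {g \<in> X \<rightarrow>\<^sub>E UNIV. short_on X \<rho> g \<and> (\<forall>z\<in>Obs. g z = h z)}"

text \<open>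
  Suprema are taken in \<^typ>\<open>ennreal\<close>, that is, in the interval from \<open>0\<close> to \<open>\<infinity>\<close>; in particular
  an unbounded set has supremum \<open>\<infinity>\<close>.
\<close>

definition mcdiarmid_subdiameter ::
    "nat \<Rightarrow> (nat \<Rightarrow> 'a set) \<Rightarrow> nat \<Rightarrow> ((nat \<Rightarrow> 'a) \<Rightarrow> real) \<Rightarrow> ennreal"
  where "mcdiarmid_subdiameter K M k f =
    Sup {ennreal \<bar>f x - f x'\<bar> | x x'.
      x \<in> PiE {1..K} M \<and> x' \<in> PiE {1..K} M \<and> (\<forall>j\<in>{1..K} - {k}. x j = x' j)}"

definition optimal_subdiameter ::
    "nat \<Rightarrow> (nat \<Rightarrow> 'a set) \<Rightarrow> (nat \<Rightarrow> 'a \<Rightarrow> 'a \<Rightarrow> real) \<Rightarrow> (nat \<Rightarrow> real) \<Rightarrow>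
      (nat \<Rightarrow> 'a) set \<Rightarrow> ((nat \<Rightarrow> 'a) \<Rightarrow> real) \<Rightarrow> nat \<Rightarrow> ennreal"
  where "optimal_subdiameter K M d L Obs G k =
    Sup {ennreal \<bar>y - y'\<bar> | x y x' y'.
      x \<in> PiE {1..K} M \<and> x' \<in> PiE {1..K} M \<and>
      (\<forall>i\<in>{1..K} - {k}. x i = x' i) \<and>
      \<bar>y - y'\<bar> \<le> L k * d k (x k) (x' k) \<and>
      (\<forall>z\<in>Obs. \<bar>y - G z\<bar> \<le> weighted_dist K L d x z \<and> \<bar>y' - G z\<bar> \<le> weighted_dist K L d x' z)}"

end

theory Submission
  imports Defs
begin

text \<open>
  The values at two points of a short extension \<open>g\<close> are feasible. Conversely, a feasible pair
  \<open>(x, y)\<close>, \<open>(x', y')\<close> together with the data on \<open>\<O>\<close> is a short function on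
  \<open>\<O> \<union> {x, x'}\<close>, which McShane's formula extends to the whole product.
\<close>

text \<open>The function \<open>g w = (INF s\<in>S. f s + \<rho> s w)\<close> is the extension: each
  function under the infimum varies by at most \<open>\<rho>\<close>, and so does their infimum.
  Only pseudometric axioms on \<open>X\<close> are assumed, because \<open>weighted_dist\<close>
  does not separate points when a weight vanishes. Nonemptiness of \<open>S\<close> keeps the
  infimum meaningful.\<close>

lemma McShane_extension:
  fixes \<rho> :: "'b \<Rightarrow> 'b \<Rightarrow> real" and f :: "'b \<Rightarrow> real"
  assumes zero: "\<And>x. x \<in> X \<Longrightarrow> \<rho> x x = 0"
    and sym: "\<And>x y. x \<in> X \<Longrightarrow> y \<in> X \<Longrightarrow> \<rho> x y = \<rho> y x"
    and tri: "\<And>x y z. x \<in> X \<Longrightarrow> y \<in> X \<Longrightarrow> z \<in> X \<Longrightarrow> \<rho> x z \<le> \<rho> x y + \<rho> y z"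
    and S: "S \<subseteq> X" "S \<noteq> {}"
    and f: "short_on S \<rho> f"
  shows "short_extensions X S f \<rho> \<noteq> {}"
proof -
  define g where "g w = (INF s\<in>S. f s + \<rho> s w)" for w
  have fdiff: "f t \<le> f s + \<rho> s t" if "s \<in> S" "t \<in> S" for s t
  proof -
    have "\<bar>f s - f t\<bar> \<le> \<rho> s t"
      using f that by (simp add: short_on_def)
    then show ?thesis by linarith
  qed
  \<comment> \<open>Any fixed \<open>t\<close> in \<open>S\<close> gives a lower bound: \<open>f t
    \<le> f s + \<rho> s t \<le> f s + \<rho> s w + \<rho> w t\<close>.\<close>
  have below: "bdd_below ((\<lambda>s. f s + \<rho> s w) ` S)" if w: "w \<in> X" for w
  proof -
    obtain t where t: "t \<in> S" using S by blast
    have "f t - \<rho> w t \<le> f s + \<rho> s w" if s: "s \<in> S" for s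
      using fdiff[OF s t] tri[of s w t] s t w S by (smt (verit) subsetD)
    then show ?thesis by (intro bdd_belowI2)
  qed
  \<comment> \<open>Bounding \<open>g v\<close> by the term of each \<open>s\<close> and passing
    from \<open>v\<close> to \<open>w\<close> costs at most \<open>\<rho> v w\<close>, uniformly in
    \<open>s\<close>, so the infimum over \<open>s\<close> can be taken. Exchanging \<open>v\<close>
    and \<open>w\<close> later gives the absolute value.\<close>
  have one_sided: "g v \<le> g w + \<rho> v w" if v: "v \<in> X" and w: "w \<in> X" for v w
  proof -
    have "g v - \<rho> v w \<le> f s + \<rho> s w" if s: "s \<in> S" for s
    proof -
      have "g v \<le> f s + \<rho> s v"
        unfolding g_def by (rule cINF_lower[OF below[OF v] s])
      moreover have "\<rho> s v \<le> \<rho> s w + \<rho> w v"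
        using tri s v w S by blast
      ultimately show ?thesis using sym[OF v w] by linarith
    qed
    then have "g v - \<rho> v w \<le> g w"
      unfolding g_def[of w] by (intro cINF_greatest S(2))
    then show ?thesis by linarith
  qed
  \<comment> \<open>The term with \<open>s = t\<close> attains the value \<open>f t\<close>, and by
    \<open>fdiff\<close> no other term is smaller.\<close>
  have eq: "g t = f t" if t: "t \<in> S" for t
  proof (rule antisym)
    have tX: "t \<in> X" using t S by blast
    have "g t \<le> f t + \<rho> t t"
      unfolding g_def by (rule cINF_lower[OF below[OF tX] t])
    then show "g t \<le> f t" by (simp add: zero[OF tX])
    show "f t \<le> g t"
      unfolding g_def by (intro cINF_greatest S(2) fdiff t)
  qed
  have short: "\<bar>g v - g w\<bar> \<le> \<rho> v w" if "v \<in> X" "w \<in> X" for v w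
    using one_sided[OF that] one_sided[OF that(2,1)] sym[OF that] by linarith
  \<comment> \<open>The restriction is taken because \<open>short_extensions\<close> contains only
    functions extensional on \<open>X\<close>.\<close>
  have "restrict g X \<in> short_extensions X S f \<rho>"
    using short eq S by (auto simp: short_extensions_def short_on_def)
  then show ?thesis by blast
qed

lemma weighted_dist_commute:
  assumes "\<And>i. i \<in> {1..K} \<Longrightarrow> Metric_space (M i) (d i)"
  shows "weighted_dist K L d x y = weighted_dist K L d y x"
  unfolding weighted_dist_def
  by (intro sum.cong refl) (simp add: Metric_space.commute[OF assms])

lemma weighted_dist_triangle:
  assumes "\<And>i. i \<in> {1..K} \<Longrightarrow> Metric_space (M i) (d i)"
    and "\<And>i. i \<in> {1..K} \<Longrightarrow> L i \<ge> 0"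
    and "x \<in> PiE {1..K} M" "y \<in> PiE {1..K} M" "z \<in> PiE {1..K} M"
  shows "weighted_dist K L d x z \<le> weighted_dist K L d x y + weighted_dist K L d y z"
  unfolding weighted_dist_def sum.distrib[symmetric] distrib_left[symmetric]
  by (intro sum_mono mult_left_mono assms(2) Metric_space.triangle[OF assms(1)])
     (use assms(3-5) in \<open>auto simp: PiE_iff\<close>)

text \<open>All summands except the \<open>k\<close>-th vanish. This identifies the constraint on
  \<open>\<bar>y - y'\<bar>\<close> with shortness between the two points.\<close>

lemma weighted_dist_eq_component:
  assumes "\<And>i. i \<in> {1..K} \<Longrightarrow> Metric_space (M i) (d i)"
    and x: "x \<in> PiE {1..K} M" and k: "k \<in> {1..K}"
    and eq: "\<forall>i\<in>{1..K} - {k}. x i = y i"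
  shows "weighted_dist K L d x y = L k * d k (x k) (y k)"
proof -
  have "d i (x i) (y i) = 0" if i: "i \<in> {1..K} - {k}" for i
    using Metric_space.mdist_zero[OF assms(1), of i "x i"] eq i PiE_mem[OF x, of i] by auto
  then have "(\<Sum>i\<in>{1..K} - {k}. L i * d i (x i) (y i)) = 0" by simp
  then show ?thesis
    unfolding weighted_dist_def using sum.remove[OF _ k, of "\<lambda>i. L i * d i (x i) (y i)"] by simp
qed

lemma weighted_dist_refl:
  assumes "\<And>i. i \<in> {1..K} \<Longrightarrow> Metric_space (M i) (d i)" and "x \<in> PiE {1..K} M"
  shows "weighted_dist K L d x x = 0"
  unfolding weighted_dist_def
  by (intro sum.neutral ballI) (simp add: Metric_space.mdist_zero[OF assms(1)] PiE_mem[OF assms(2)])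

theorem theorem3p1:
  fixes K k :: nat
    and M :: "nat \<Rightarrow> 'a set"
    and d :: "nat \<Rightarrow> 'a \<Rightarrow> 'a \<Rightarrow> real"
    and L :: "nat \<Rightarrow> real"
    and Obs :: "(nat \<Rightarrow> 'a) set"
    and G :: "(nat \<Rightarrow> 'a) \<Rightarrow> real"
  assumes "K \<ge> 1"
    and "\<And>i. i \<in> {1..K} \<Longrightarrow> Metric_space (M i) (d i)"
    and "\<And>i. i \<in> {1..K} \<Longrightarrow> M i \<noteq> {}"
    and "\<And>i. i \<in> {1..K} \<Longrightarrow> L i \<ge> 0"
    and "Obs \<subseteq> PiE {1..K} M"
    and "short_on (PiE {1..K} M) (weighted_dist K L d) G"
    and "k \<in> {1..K}"
  shows "optimal_subdiameter K M d L Obs G k =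
    Sup {mcdiarmid_subdiameter K M k g | g.
      g \<in> short_extensions (PiE {1..K} M) Obs (restrict G Obs) (weighted_dist K L d)}"
proof (rule antisym)
  let ?X = "PiE {1..K} M" and ?\<rho> = "weighted_dist K L d"
  let ?E = "short_extensions ?X Obs (restrict G Obs) ?\<rho>"
  have refl0: "?\<rho> x x = 0" if "x \<in> ?X" for x
    using assms(2) that by (rule weighted_dist_refl)
  have commute: "?\<rho> x y = ?\<rho> y x" for x y
    using assms(2) by (rule weighted_dist_commute)
  have triangle: "?\<rho> x z \<le> ?\<rho> x y + ?\<rho> y z" if "x \<in> ?X" "y \<in> ?X" "z \<in> ?X" for x y z
    using assms(2,4) that by (rule weighted_dist_triangle)
  have component: "?\<rho> x y = L k * d k (x k) (y k)"
    if "x \<in> ?X" "\<forall>i\<in>{1..K} - {k}. x i = y i" for x y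
    using assms(2) that(1) assms(7) that(2) by (rule weighted_dist_eq_component)
  show "optimal_subdiameter K M d L Obs G k \<le> Sup {mcdiarmid_subdiameter K M k g | g. g \<in> ?E}"
    unfolding optimal_subdiameter_def
  proof (rule Sup_least, clarify)
    fix x y x' y'
    assume x: "x \<in> ?X" and x': "x' \<in> ?X" and eq: "\<forall>i\<in>{1..K} - {k}. x i = x' i"
      and le: "\<bar>y - y'\<bar> \<le> L k * d k (x k) (x' k)"
      and obs: "\<forall>z\<in>Obs. \<bar>y - G z\<bar> \<le> ?\<rho> x z \<and> \<bar>y' - G z\<bar> \<le> ?\<rho> x' z"
    \<comment> \<open>The points \<open>x\<close> and \<open>x'\<close> may coincide or lie in
      \<open>Obs\<close>, so the branches can overlap. Then the constraints bound the difference of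
      the competing values by a distance \<open>0\<close>, hence \<open>f\<close> takes all the
      prescribed values.\<close>
    define f where "f w = (if w = x then y else if w = x' then y' else G w)" for w
    have yy: "\<bar>y - y'\<bar> \<le> ?\<rho> x x'"
      using le component[OF x eq] by simp
    have fx': "f x' = y'"
      using yy refl0[OF x] by (auto simp: f_def)
    have fx: "f x = y"
      by (simp add: f_def)
    have fobs: "f z = G z" if z: "z \<in> Obs" for z
      using obs z refl0[OF x] refl0[OF x'] by (auto simp: f_def)
    \<comment> \<open>This set is nonempty even when \<open>Obs\<close> is empty, as the extension
      lemma requires.\<close>
    let ?S = "insert x (insert x' Obs)"
    have S: "?S \<subseteq> ?X"
      using x x' assms(5) by simp
    have "\<bar>f v - f w\<bar> \<le> ?\<rho> v w" if v: "v \<in> ?S" and w: "w \<in> ?S" for v w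
    proof -
      have GG: "\<bar>G v - G w\<bar> \<le> ?\<rho> v w" if "v \<in> Obs" "w \<in> Obs"
        using assms(5,6) that unfolding short_on_def by blast
      have obs': "\<bar>f u - f z\<bar> \<le> ?\<rho> u z" if "u = x \<or> u = x'" "z \<in> Obs" for u z
        using obs that fx fx' fobs by auto
      have xx: "\<bar>f x - f x'\<bar> \<le> ?\<rho> x x'"
        using yy fx fx' by simp
      \<comment> \<open>Pairs inside \<open>Obs\<close> use shortness of \<open>G\<close>, mixed
        pairs use the observation constraints, and the pair \<open>x\<close>, \<open>x'\<close> uses
        \<open>yy\<close>.\<close>
      consider "v = w" | "v \<in> Obs" "w \<in> Obs" | "v = x \<or> v = x'" "w \<in> Obs"
        | "w = x \<or> w = x'" "v \<in> Obs" | "v = x" "w = x'" | "v = x'" "w = x"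
        using v w by blast
      then show ?thesis
      proof cases
        case 1
        then show ?thesis using refl0[of v] S v by auto
      next
        case 2
        then show ?thesis using GG fobs by simp
      next
        case 3
        then show ?thesis by (rule obs')
      next
        case 4
        then show ?thesis using obs'[of w v] commute[of v w] by linarith
      next
        case 5
        then show ?thesis using xx by simp
      next
        case 6
        then show ?thesis using xx commute[of v w] by (simp add: abs_minus_commute)
      qed
    qed
    then have short: "short_on ?S ?\<rho> f"
      unfolding short_on_def by blast
    have "short_extensions ?X ?S f ?\<rho> \<noteq> {}"
      using refl0 commute triangle S insert_not_empty short by (rule McShane_extension)
    then obtain g where g: "g \<in> short_extensions ?X ?S f ?\<rho>"
      by blast
    then have gx: "g x = y" "g x' = y'"
      using fx fx' by (simp_all add: short_extensions_def)
    \<comment> \<open>Since \<open>?S\<close> contains \<open>Obs\<close> and \<open>f\<close>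
      agrees with \<open>G\<close> there, extending \<open>f\<close> from \<open>?S\<close> also
      extends the data on \<open>Obs\<close>.\<close>
    have "g \<in> ?E"
      using g fobs by (simp add: short_extensions_def)
    moreover have "ennreal \<bar>y - y'\<bar> \<le> mcdiarmid_subdiameter K M k g"
      unfolding mcdiarmid_subdiameter_def gx[symmetric]
      by (intro Sup_upper CollectI exI conjI) (rule refl x x' eq)+
    ultimately show "ennreal \<bar>y - y'\<bar> \<le> Sup {mcdiarmid_subdiameter K M k g | g. g \<in> ?E}"
      by (blast intro: Sup_upper2)
  qed
  show "Sup {mcdiarmid_subdiameter K M k g | g. g \<in> ?E} \<le> optimal_subdiameter K M d L Obs G k"
  proof (rule Sup_least, clarify)
    fix g
    assume "g \<in> ?E"
    then have short: "\<And>v w. v \<in> ?X \<Longrightarrow> w \<in> ?X \<Longrightarrow> \<bar>g v - g w\<bar> \<le> ?\<rho> v w"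
      and gG: "\<And>z. z \<in> Obs \<Longrightarrow> g z = G z"
      by (auto simp: short_extensions_def short_on_def)
    \<comment> \<open>Shortness of \<open>g\<close> between \<open>v\<close> and an observed point,
      where \<open>g\<close> equals \<open>G\<close>, is the observation constraint for the value
      \<open>g v\<close>.\<close>
    have obs: "\<forall>z\<in>Obs. \<bar>g v - G z\<bar> \<le> ?\<rho> v z" if "v \<in> ?X" for v
      proof
      fix z assume z: "z \<in> Obs"
      then have "z \<in> ?X" using assms(5) by blast
      from short[OF that this] show "\<bar>g v - G z\<bar> \<le> ?\<rho> v z" by (simp only: gG[OF z])
    qed
    show "mcdiarmid_subdiameter K M k g \<le> optimal_subdiameter K M d L Obs G k"
      unfolding mcdiarmid_subdiameter_def
    proof (rule Sup_least, clarify)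
      fix x x'
      assume x: "x \<in> ?X" and x': "x' \<in> ?X" and eq: "\<forall>j\<in>{1..K} - {k}. x j = x' j"
      \<comment> \<open>This is the remaining constraint for the feasible choice
        \<open>y = g x\<close>, \<open>y' = g x'\<close>.\<close>
      have "\<bar>g x - g x'\<bar> \<le> L k * d k (x k) (x' k)"
        using short[OF x x'] component[OF x eq] by simp
      then show "ennreal \<bar>g x - g x'\<bar> \<le> optimal_subdiameter K M d L Obs G k"
        unfolding optimal_subdiameter_def
        by (intro Sup_upper CollectI exI conjI) (use x x' eq obs[OF x] obs[OF x'] in auto)
    qed
  qed
qed

end
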